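(* Let $r,n,m,M,k,s,q\geq 1$ be integers with $n=2^mM$, where $\gcd(M,6)=1$, and suppose that $r\geq s$. If the Prishchepov group $P(r,n,k,s,q)$ is perfect, then one of the following holds: (1) $P(r,n,k,s,q)$ is trivially perfect; (2) $P(r,M,k,s,q)$ is of type $\widetilde{\mathfrak Z}$.
   Context: For $n\ge 1$ let $F_n$ be the free group on $x_0,\dots,x_{n-1}$ and let $\theta\in\operatorname{Aut}(F_n)$ be given by $\theta(x_i)=x_{(i+1)\bmod n}$. For $w\in F_n$, $G_n(w)$ is the group with presentation $\langle x_0,\dots,x_{n-1}\mid w,\theta(w),\dots,\theta^{n-1}(w)\rangle$. For integers $r,n,k,s,q\ge 1$, the Prishchepov group is $P(r,n,k,s,q)=G_n(w)$ with $$w=\Bigl(\prod_{i=0}^{r-1}x_{iq}\Bigr)\Bigl(\prod_{i=0}^{s-1}x_{k-1+iq}\Bigr)^{-1},$$ subscripts taken modulo $n$, and products written in order of increasing $i$. A group is perfect if its abelianisation is trivial. $P(r,n,k,s,q)$ is called trivially perfect if $|r-s|=1$ and at least one of the following congruences holds modulo $n$: $k\equiv 1$; $k\equiv 1+q$; $\gcd(q,n)\,r\equiv 0$; $\gcd(q,n)\,s\equiv 0$. (This is a condition on the parameters.) $P(r,n,k,s,q)$ is said to be of type $\widetilde{\mathfrak Z}$ if $q(r-s)\equiv 2(k-1)\pmod n$ or $q(r+s)\equiv 0\pmod n$. (This is a condition on the parameters; for $P(r,M,k,s,q)$ the congruences are modulo $M$.) *)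

theory Defs
  imports "HOL-Algebra.Elementary_Groups" "HOL-Number_Theory.Cong"
begin

section \<open>Free groups\<close>

text \<open>
  The letter \<open>(True, x)\<close> stands for the generator \<open>x\<close> and \<open>(False, x)\<close> for its inverse.
  The free group on \<open>X\<close> consists of the words over \<open>X\<close> modulo insertion and deletion of
  adjacent mutually inverse letters.
\<close>

type_synonym 'a letter = "bool \<times> 'a"

definition inv_letter :: "'a letter \<Rightarrow> 'a letter"
  where "inv_letter l = (\<not> fst l, snd l)"

abbreviation words_over :: "'a set \<Rightarrow> 'a letter list set"
  where "words_over X \<equiv> lists (UNIV \<times> X)"

inductive_set free_eq :: "'a set \<Rightarrow> ('a letter list \<times> 'a letter list) set" for X where
  cancel: "u \<in> words_over X \<Longrightarrow> v \<in> words_over X \<Longrightarrow> snd l \<in> X \<Longrightarrow>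
    (u @ [l, inv_letter l] @ v, u @ v) \<in> free_eq X"
| refl: "u \<in> words_over X \<Longrightarrow> (u, u) \<in> free_eq X"
| sym: "(u, v) \<in> free_eq X \<Longrightarrow> (v, u) \<in> free_eq X"
| trans: "(u, v) \<in> free_eq X \<Longrightarrow> (v, w) \<in> free_eq X \<Longrightarrow> (u, w) \<in> free_eq X"

definition free_group :: "'a set \<Rightarrow> 'a letter list set monoid" where
  "free_group X =
    \<lparr>carrier = words_over X // free_eq X,
     monoid.mult = (\<lambda>A B. \<Union>a\<in>A. \<Union>b\<in>B. free_eq X `` {a @ b}),
     one = free_eq X `` {[]}\<rparr>"

definition free_gen :: "'a set \<Rightarrow> 'a \<Rightarrow> 'a letter list set"
  where "free_gen X x = free_eq X `` {[(True, x)]}"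

definition list_prod :: "('g, 'b) monoid_scheme \<Rightarrow> 'g list \<Rightarrow> 'g"
  where "list_prod G xs = foldr (\<otimes>\<^bsub>G\<^esub>) xs \<one>\<^bsub>G\<^esub>"

definition eval_letter :: "('g, 'b) monoid_scheme \<Rightarrow> ('a \<Rightarrow> 'g) \<Rightarrow> 'a letter \<Rightarrow> 'g"
  where "eval_letter G f l = (if fst l then f (snd l) else inv\<^bsub>G\<^esub> f (snd l))"

text \<open>
  The homomorphism from a free group to \<open>G\<close> that sends each generator \<open>x\<close> to \<open>f x\<close>;
  all words in a class have the same value, see \<open>free_lift_class\<close> below.
\<close>

definition free_lift :: "('g, 'b) monoid_scheme \<Rightarrow> ('a \<Rightarrow> 'g) \<Rightarrow> 'a letter list set \<Rightarrow> 'g"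
  where "free_lift G f A = the_elem ((\<lambda>u. list_prod G (map (eval_letter G f) u)) ` A)"

lemma free_eq_words: "(u, v) \<in> free_eq X \<Longrightarrow> u \<in> words_over X \<and> v \<in> words_over X"
  by (induction rule: free_eq.induct) (auto simp: inv_letter_def mem_Times_iff)

lemma equiv_free_eq: "equiv (words_over X) (free_eq X)"
proof (rule equivI)
  show "free_eq X \<subseteq> words_over X \<times> words_over X"
    using free_eq_words by fastforce
  show "refl_on (words_over X) (free_eq X)"
    by (auto intro!: refl_onI free_eq.refl)
  show "Relation.sym (free_eq X)"
    by (rule symI) (rule free_eq.sym)
  show "Relation.trans (free_eq X)"
    by (rule transI) (rule free_eq.trans)
qed

lemma free_eq_append_left:
  assumes "(u, v) \<in> free_eq X" "w \<in> words_over X"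
  shows "(w @ u, w @ v) \<in> free_eq X"
  using assms
proof (induction rule: free_eq.induct)
  case (cancel u v l)
  then show ?case using free_eq.cancel[of "w @ u" X v l] by simp
next
  case (refl u)
  then show ?case by (intro free_eq.refl) simp
next
  case (sym u v)
  then show ?case by (blast intro: free_eq.sym)
next
  case (trans u v w)
  then show ?case by (blast intro: free_eq.trans)
qed

lemma free_eq_append_right:
  assumes "(u, v) \<in> free_eq X" "w \<in> words_over X"
  shows "(u @ w, v @ w) \<in> free_eq X"
  using assms
proof (induction rule: free_eq.induct)
  case (cancel u v l)
  then show ?case using free_eq.cancel[of u X "v @ w" l] by simp
next
  case (refl u)
  then show ?case by (intro free_eq.refl) simp
next
  case (sym u v)
  then show ?case by (blast intro: free_eq.sym)
next
  case (trans u v w)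
  then show ?case by (blast intro: free_eq.trans)
qed

lemma free_eq_append:
  "(u, u') \<in> free_eq X \<Longrightarrow> (v, v') \<in> free_eq X \<Longrightarrow> (u @ v, u' @ v') \<in> free_eq X"
  by (meson free_eq.trans free_eq_append_left free_eq_append_right free_eq_words)

lemma free_group_mult_class:
  assumes "u \<in> words_over X" "v \<in> words_over X"
  shows "free_eq X `` {u} \<otimes>\<^bsub>free_group X\<^esub> free_eq X `` {v} = free_eq X `` {u @ v}"
proof -
  have "congruent2 (free_eq X) (free_eq X) (\<lambda>a b. free_eq X `` {a @ b})"
    by (rule congruent2I') (intro equiv_class_eq[OF equiv_free_eq] free_eq_append)
  then show ?thesis
    using UN_equiv_class2[OF equiv_free_eq equiv_free_eq _ assms]
    by (simp add: free_group_def)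
qed

lemma free_group_one: "\<one>\<^bsub>free_group X\<^esub> = free_eq X `` {[]}"
  by (simp add: free_group_def)

lemma free_group_carrier: "carrier (free_group X) = words_over X // free_eq X"
  by (simp add: free_group_def)

lemma class_in_free_group: "u \<in> words_over X \<Longrightarrow> free_eq X `` {u} \<in> carrier (free_group X)"
  by (simp add: free_group_carrier quotientI)

lemma free_group_cases:
  assumes "A \<in> carrier (free_group X)"
  obtains u where "u \<in> words_over X" "A = free_eq X `` {u}"
  using assms unfolding free_group_carrier by (rule quotientE)

lemma inv_word_cancel:
  "u \<in> words_over X \<Longrightarrow>
    rev (map inv_letter u) \<in> words_over X \<and> (rev (map inv_letter u) @ u, []) \<in> free_eq X"
proof (induction u)
  case Nil
  then show ?case by (simp add: free_eq.refl)
next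
  case (Cons l u)
  let ?r = "rev (map inv_letter u)"
  have l: "snd l \<in> X" and u: "u \<in> words_over X"
    using Cons.prems by auto
  have r: "?r \<in> words_over X" "(?r @ u, []) \<in> free_eq X"
    using Cons.IH u by auto
  have "(?r @ [inv_letter l, inv_letter (inv_letter l)] @ u, ?r @ u) \<in> free_eq X"
    using r u l by (intro free_eq.cancel) (auto simp: inv_letter_def)
  then have "(rev (map inv_letter (l # u)) @ l # u, []) \<in> free_eq X"
    using free_eq.trans[OF _ r(2)] by (simp add: inv_letter_def)
  moreover have "rev (map inv_letter (l # u)) \<in> words_over X"
    using r(1) l by (auto simp: inv_letter_def)
  ultimately show ?case by blast
qed

lemma group_free_group: "group (free_group X)"
proof (rule groupI)
  fix A B C
  assume ABC: "A \<in> carrier (free_group X)" "B \<in> carrier (free_group X)" "C \<in> carrier (free_group X)"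
  obtain u where "u \<in> words_over X" "A = free_eq X `` {u}"
    using ABC(1) by (rule free_group_cases)
  moreover obtain v where "v \<in> words_over X" "B = free_eq X `` {v}"
    using ABC(2) by (rule free_group_cases)
  moreover obtain w where "w \<in> words_over X" "C = free_eq X `` {w}"
    using ABC(3) by (rule free_group_cases)
  ultimately show "A \<otimes>\<^bsub>free_group X\<^esub> B \<otimes>\<^bsub>free_group X\<^esub> C = A \<otimes>\<^bsub>free_group X\<^esub> (B \<otimes>\<^bsub>free_group X\<^esub> C)"
    by (simp add: free_group_mult_class)
next
  fix A B
  assume AB: "A \<in> carrier (free_group X)" "B \<in> carrier (free_group X)"
  obtain u where "u \<in> words_over X" "A = free_eq X `` {u}"
    using AB(1) by (rule free_group_cases)
  moreover obtain v where "v \<in> words_over X" "B = free_eq X `` {v}"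
    using AB(2) by (rule free_group_cases)
  ultimately show "A \<otimes>\<^bsub>free_group X\<^esub> B \<in> carrier (free_group X)"
    by (simp add: free_group_mult_class class_in_free_group)
next
  show "\<one>\<^bsub>free_group X\<^esub> \<in> carrier (free_group X)"
    by (simp add: free_group_one class_in_free_group)
next
  fix A
  assume "A \<in> carrier (free_group X)"
  then obtain u where u: "u \<in> words_over X" "A = free_eq X `` {u}"
    by (rule free_group_cases)
  then show "\<one>\<^bsub>free_group X\<^esub> \<otimes>\<^bsub>free_group X\<^esub> A = A"
    by (simp add: free_group_one free_group_mult_class)
  have "free_eq X `` {rev (map inv_letter u)} \<otimes>\<^bsub>free_group X\<^esub> A = \<one>\<^bsub>free_group X\<^esub>"
    using inv_word_cancel[OF u(1)] equiv_class_eq[OF equiv_free_eq, of "rev (map inv_letter u) @ u" "[]"]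
    by (simp only: u free_group_one free_group_mult_class)
  then show "\<exists>B\<in>carrier (free_group X). B \<otimes>\<^bsub>free_group X\<^esub> A = \<one>\<^bsub>free_group X\<^esub>"
    using class_in_free_group[OF conjunct1[OF inv_word_cancel[OF u(1)]]] by (rule bexI)
qed

lemma free_gen_closed: "x \<in> X \<Longrightarrow> free_gen X x \<in> carrier (free_group X)"
  by (simp add: free_gen_def class_in_free_group)

context group
begin

lemma eval_letter_closed: "f \<in> X \<rightarrow> carrier G \<Longrightarrow> snd l \<in> X \<Longrightarrow> eval_letter G f l \<in> carrier G"
  by (auto simp: eval_letter_def Pi_iff)

lemma list_prod_closed: "set xs \<subseteq> carrier G \<Longrightarrow> list_prod G xs \<in> carrier G"
  by (induction xs) (auto simp: list_prod_def)

lemma list_prod_append: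
  "set xs \<subseteq> carrier G \<Longrightarrow> set ys \<subseteq> carrier G \<Longrightarrow>
    list_prod G (xs @ ys) = list_prod G xs \<otimes> list_prod G ys"
proof (induction xs)
  case Nil
  then show ?case using list_prod_closed[of ys] by (simp add: list_prod_def)
next
  case (Cons x xs)
  then show ?case
    using list_prod_closed[of xs] list_prod_closed[of ys]
    by (simp add: list_prod_def m_assoc)
qed

lemma eval_word_closed:
  "f \<in> X \<rightarrow> carrier G \<Longrightarrow> u \<in> words_over X \<Longrightarrow> set (map (eval_letter G f) u) \<subseteq> carrier G"
  using eval_letter_closed[of f X] by auto

lemma eval_word_cong:
  assumes "f \<in> X \<rightarrow> carrier G" "(u, v) \<in> free_eq X"
  shows "list_prod G (map (eval_letter G f) u) = list_prod G (map (eval_letter G f) v)"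
  using assms(2)
proof (induction rule: free_eq.induct)
  case (cancel u v l)
  have c: "set (map (eval_letter G f) u) \<subseteq> carrier G" "set (map (eval_letter G f) v) \<subseteq> carrier G"
    "eval_letter G f l \<in> carrier G" "eval_letter G f (inv_letter l) \<in> carrier G"
    using cancel eval_word_closed[OF assms(1)] eval_letter_closed[OF assms(1)]
    by (auto simp: inv_letter_def)
  have "f (snd l) \<in> carrier G"
    using cancel assms(1) by auto
  then have "eval_letter G f l \<otimes> eval_letter G f (inv_letter l) = \<one>"
    by (simp add: eval_letter_def inv_letter_def)
  then have one: "list_prod G [eval_letter G f l, eval_letter G f (inv_letter l)] = \<one>"
    using c by (simp add: list_prod_def)
  let ?u = "map (eval_letter G f) u" and ?v = "map (eval_letter G f) v"
  have "list_prod G (?u @ [eval_letter G f l, eval_letter G f (inv_letter l)] @ ?v)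
      = list_prod G ?u \<otimes> (list_prod G [eval_letter G f l, eval_letter G f (inv_letter l)] \<otimes> list_prod G ?v)"
    using c list_prod_append[of ?u "[eval_letter G f l, eval_letter G f (inv_letter l)] @ ?v"]
      list_prod_append[of "[eval_letter G f l, eval_letter G f (inv_letter l)]" ?v] by simp
  also have "\<dots> = list_prod G (?u @ ?v)"
    using c one list_prod_closed[of ?v] list_prod_append[of ?u ?v] by simp
  finally show ?case by simp
qed auto

lemma free_lift_class:
  assumes "f \<in> X \<rightarrow> carrier G" "u \<in> words_over X"
  shows "free_lift G f (free_eq X `` {u}) = list_prod G (map (eval_letter G f) u)"
proof -
  let ?e = "\<lambda>v. list_prod G (map (eval_letter G f) v)"
  have "?e v = ?e u" if "v \<in> free_eq X `` {u}" for v
  proof -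
    have "(u, v) \<in> free_eq X" using that by blast
    then show ?thesis by (rule eval_word_cong[OF assms(1), symmetric])
  qed
  moreover have "u \<in> free_eq X `` {u}"
    using free_eq.refl[OF assms(2)] by blast
  ultimately have "?e ` (free_eq X `` {u}) = {?e u}"
    by blast
  then show ?thesis by (simp add: free_lift_def)
qed

lemma free_lift_hom:
  assumes "f \<in> X \<rightarrow> carrier G"
  shows "free_lift G f \<in> hom (free_group X) G"
proof (rule homI)
  fix A assume "A \<in> carrier (free_group X)"
  then obtain u where "u \<in> words_over X" "A = free_eq X `` {u}"
    by (rule free_group_cases)
  then show "free_lift G f A \<in> carrier G"
    using list_prod_closed[OF eval_word_closed[OF assms]] free_lift_class[OF assms] by simp
next
  fix A B assume AB: "A \<in> carrier (free_group X)" "B \<in> carrier (free_group X)"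
  obtain u where u: "u \<in> words_over X" "A = free_eq X `` {u}"
    using AB(1) by (rule free_group_cases)
  obtain v where v: "v \<in> words_over X" "B = free_eq X `` {v}"
    using AB(2) by (rule free_group_cases)
  have "u @ v \<in> words_over X" using u v by simp
  then show "free_lift G f (A \<otimes>\<^bsub>free_group X\<^esub> B) = free_lift G f A \<otimes> free_lift G f B"
    using u v free_lift_class[OF assms] eval_word_closed[OF assms]
    by (simp add: free_group_mult_class list_prod_append)
qed

lemma free_lift_gen:
  assumes "f \<in> X \<rightarrow> carrier G" "x \<in> X"
  shows "free_lift G f (free_gen X x) = f x"
proof -
  have "f x \<in> carrier G" "[(True, x)] \<in> words_over X"
    using assms by auto
  then show ?thesis
    using free_lift_class[OF assms(1), of "[(True, x)]"]
    by (simp add: free_gen_def list_prod_def eval_letter_def)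
qed

end

lemma class_eq_list_prod:
  assumes "u \<in> words_over X"
  shows "free_eq X `` {u} = list_prod (free_group X) (map (eval_letter (free_group X) (free_gen X)) u)"
  using assms
proof (induction u rule: list.induct)
  case Nil
  then show ?case by (simp add: list_prod_def free_group_one)
next
  case (Cons l u)
  interpret F: group "free_group X" by (rule group_free_group)
  have l: "snd l \<in> X" and lw: "[l] \<in> words_over X" and u: "u \<in> words_over X"
    using Cons.prems by auto
  have "eval_letter (free_group X) (free_gen X) l = free_eq X `` {[l]}"
  proof (cases "fst l")
    case True
    then show ?thesis by (cases l) (simp add: eval_letter_def free_gen_def)
  next
    case False
    have "free_eq X `` {[l]} \<otimes>\<^bsub>free_group X\<^esub> free_gen X (snd l) = \<one>\<^bsub>free_group X\<^esub>"
      using free_eq.cancel[of "[]" X "[]" l] False l lw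
      by (cases l) (auto simp: free_gen_def free_group_mult_class free_group_one inv_letter_def
          intro!: equiv_class_eq[OF equiv_free_eq])
    then have "inv\<^bsub>free_group X\<^esub> free_gen X (snd l) = free_eq X `` {[l]}"
      by (rule F.inv_equality) (rule free_gen_closed[OF l], rule class_in_free_group[OF lw])
    then show ?thesis
      using False by (simp add: eval_letter_def)
  qed
  moreover have "free_eq X `` {l # u} = free_eq X `` {[l]} \<otimes>\<^bsub>free_group X\<^esub> free_eq X `` {u}"
    using free_group_mult_class[OF lw u] by simp
  ultimately show ?case
    using Cons.IH[OF u] by (simp add: list_prod_def)
qed

lemma free_hom_ext:
  assumes "group G" "h \<in> hom (free_group X) G" "h' \<in> hom (free_group X) G"
    and gen: "\<And>x. x \<in> X \<Longrightarrow> h (free_gen X x) = h' (free_gen X x)"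
    and A: "A \<in> carrier (free_group X)"
  shows "h A = h' A"
proof -
  interpret F: group "free_group X" by (rule group_free_group)
  interpret h: group_hom "free_group X" G h
    using assms by (simp add: group_hom_def group_hom_axioms_def group_free_group)
  interpret h': group_hom "free_group X" G h'
    using assms by (simp add: group_hom_def group_hom_axioms_def group_free_group)
  let ?e = "eval_letter (free_group X) (free_gen X)"
  have gens: "free_gen X \<in> X \<rightarrow> carrier (free_group X)"
    by (simp add: free_gen_closed)
  have "h (list_prod (free_group X) (map ?e u)) = h' (list_prod (free_group X) (map ?e u))"
    if "u \<in> words_over X" for u
    using that
  proof (induction u rule: list.induct)
    case Nil
    then show ?case by (simp add: list_prod_def)
  next
    case (Cons l u)
    have "snd l \<in> X" "u \<in> words_over X" using Cons.prems by auto
    moreover from this have "?e l \<in> carrier (free_group X)"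
      "list_prod (free_group X) (map ?e u) \<in> carrier (free_group X)"
      using F.eval_letter_closed[OF gens] F.list_prod_closed[OF F.eval_word_closed[OF gens]] by auto
    moreover have "h (?e l) = h' (?e l)"
      using \<open>snd l \<in> X\<close> gen free_gen_closed[of "snd l" X]
      by (simp add: eval_letter_def h.hom_inv h'.hom_inv)
    ultimately show ?case
      using Cons.IH by (simp add: list_prod_def)
  qed
  then show ?thesis
    using A class_eq_list_prod by (metis free_group_cases)
qed


section \<open>Group presentations\<close>

definition normal_closure :: "('g, 'b) monoid_scheme \<Rightarrow> 'g set \<Rightarrow> 'g set"
  where "normal_closure G R = \<Inter>{N. N \<lhd> G \<and> R \<subseteq> N}"

text \<open>Relators are elements of the free group.\<close>

definition presented_group :: "'a set \<Rightarrow> 'a letter list set set \<Rightarrow> 'a letter list set set monoid"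
  where "presented_group X R = free_group X Mod normal_closure (free_group X) R"

lemma (in group) normal_closure_normal:
  assumes "R \<subseteq> carrier G"
  shows "normal_closure G R \<lhd> G"
proof -
  let ?S = "{N. N \<lhd> G \<and> R \<subseteq> N}"
  have S: "carrier G \<in> ?S"
    using assms normal_self by simp
  have "subgroup (\<Inter>?S) G"
    using S by (intro subgroups_Inter) (auto intro: normal_imp_subgroup)
  moreover have "x \<otimes> h \<otimes> inv x \<in> \<Inter>?S" if "x \<in> carrier G" "h \<in> \<Inter>?S" for x h
    using that by (auto intro: normal_invE(2))
  ultimately show ?thesis
    unfolding normal_closure_def by (rule normal_invI)
qed

lemma group_presented_group:
  "R \<subseteq> carrier (free_group X) \<Longrightarrow> group (presented_group X R)"
  unfolding presented_group_def
  by (intro normal.factorgroup_is_group group.normal_closure_normal group_free_group)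


section \<open>Cyclically presented groups\<close>

abbreviation cyc_free_group :: "nat \<Rightarrow> nat letter list set monoid"
  where "cyc_free_group n \<equiv> free_group {..<n}"

definition cyc_gen :: "nat \<Rightarrow> nat \<Rightarrow> nat letter list set"
  where "cyc_gen n i = free_gen {..<n} (i mod n)"

definition shift_aut :: "nat \<Rightarrow> nat letter list set \<Rightarrow> nat letter list set"
  where "shift_aut n = free_lift (cyc_free_group n) (\<lambda>i. cyc_gen n (i + 1))"

definition cyc_presented :: "nat \<Rightarrow> nat letter list set \<Rightarrow> nat letter list set set monoid"
  where "cyc_presented n w = presented_group {..<n} ((\<lambda>j. (shift_aut n ^^ j) w) ` {..<n})"

lemma cyc_gen_closed: "n \<ge> 1 \<Longrightarrow> cyc_gen n i \<in> carrier (cyc_free_group n)"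
  by (simp add: cyc_gen_def free_gen_closed)

lemma shift_aut_hom: "n \<ge> 1 \<Longrightarrow> shift_aut n \<in> hom (cyc_free_group n) (cyc_free_group n)"
  unfolding shift_aut_def
  by (intro group.free_lift_hom group_free_group) (simp add: cyc_gen_closed)

lemma shift_aut_gen: "n \<ge> 1 \<Longrightarrow> shift_aut n (cyc_gen n i) = cyc_gen n (i + 1)"
  using group.free_lift_gen[OF group_free_group, of "\<lambda>i. cyc_gen n (i + 1)" "{..<n}" "{..<n}" "i mod n"]
  by (simp add: shift_aut_def cyc_gen_closed cyc_gen_def mod_simps free_gen_closed)

lemma shift_aut_funpow_hom:
  "n \<ge> 1 \<Longrightarrow> shift_aut n ^^ j \<in> hom (cyc_free_group n) (cyc_free_group n)"
proof (induction j)
  case 0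
  then show ?case by (simp add: hom_def)
next
  case (Suc j)
  then show ?case
    using hom_compose[OF Suc.IH shift_aut_hom] by (simp add: o_def)
qed

lemma shift_aut_funpow_gen: "n \<ge> 1 \<Longrightarrow> (shift_aut n ^^ j) (cyc_gen n i) = cyc_gen n (i + j)"
  by (induction j) (simp_all add: shift_aut_gen)

lemma shift_aut_funpow_n:
  assumes "n \<ge> 1" "A \<in> carrier (cyc_free_group n)"
  shows "(shift_aut n ^^ n) A = A"
proof -
  have "(shift_aut n ^^ n) (free_gen {..<n} x) = free_gen {..<n} x" if "x < n" for x
    using shift_aut_funpow_gen[OF assms(1), of n x] that by (simp add: cyc_gen_def)
  then show ?thesis
    using free_hom_ext[OF group_free_group shift_aut_funpow_hom[OF assms(1)] _ _ assms(2), of "\<lambda>x. x" n]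
    by (simp add: hom_def)
qed

lemma shift_aut_iso:
  assumes "n \<ge> 1"
  shows "shift_aut n \<in> iso (cyc_free_group n) (cyc_free_group n)"
proof -
  let ?F = "carrier (cyc_free_group n)"
  have n: "Suc (n - 1) = n" using assms by simp
  have "bij_betw (shift_aut n) ?F ?F"
  proof (rule bij_betw_byWitness[where f' = "shift_aut n ^^ (n - 1)"])
    show "\<forall>a\<in>?F. (shift_aut n ^^ (n - 1)) (shift_aut n a) = a"
      using shift_aut_funpow_n[OF assms] n by (metis funpow_Suc_right comp_apply)
    show "\<forall>a\<in>?F. shift_aut n ((shift_aut n ^^ (n - 1)) a) = a"
      using shift_aut_funpow_n[OF assms] n by (metis funpow.simps(2) comp_apply)
  qed (use shift_aut_hom[OF assms] shift_aut_funpow_hom[OF assms] in \<open>auto simp: hom_def\<close>)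
  then show ?thesis using shift_aut_hom[OF assms] by (simp add: iso_def)
qed

lemma group_cyc_presented:
  "n \<ge> 1 \<Longrightarrow> w \<in> carrier (cyc_free_group n) \<Longrightarrow> group (cyc_presented n w)"
  unfolding cyc_presented_def
  by (intro group_presented_group) (use shift_aut_funpow_hom in \<open>fastforce simp: hom_def\<close>)


section \<open>Prishchepov groups\<close>

definition prishchepov_word :: "nat \<Rightarrow> nat \<Rightarrow> nat \<Rightarrow> nat \<Rightarrow> nat \<Rightarrow> nat letter list set" where
  "prishchepov_word r n k s q =
    list_prod (cyc_free_group n) (map (\<lambda>i. cyc_gen n (i * q)) [0..<r])
    \<otimes>\<^bsub>cyc_free_group n\<^esub>
    inv\<^bsub>cyc_free_group n\<^esub>
      list_prod (cyc_free_group n) (map (\<lambda>i. cyc_gen n (k - 1 + i * q)) [0..<s])"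

text \<open>All parameters are meant to be positive; in particular \<open>k - 1\<close> above is then not truncated.\<close>

definition prishchepov :: "nat \<Rightarrow> nat \<Rightarrow> nat \<Rightarrow> nat \<Rightarrow> nat \<Rightarrow> nat letter list set set monoid"
  where "prishchepov r n k s q = cyc_presented n (prishchepov_word r n k s q)"

lemma group_prishchepov: "n \<ge> 1 \<Longrightarrow> group (prishchepov r n k s q)"
  unfolding prishchepov_def prishchepov_word_def
  by (intro group_cyc_presented monoid.m_closed group.inv_closed group.list_prod_closed
      group_free_group group.is_monoid)
    (auto simp: cyc_gen_closed)

definition perfect_group :: "('g, 'b) monoid_scheme \<Rightarrow> bool"
  where "perfect_group G \<longleftrightarrow> trivial_group (G Mod derived G (carrier G))"

definition trivially_perfect :: "nat \<Rightarrow> nat \<Rightarrow> nat \<Rightarrow> nat \<Rightarrow> nat \<Rightarrow> bool" where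
  "trivially_perfect r n k s q \<longleftrightarrow>
    \<bar>int r - int s\<bar> = 1 \<and>
    ([k = 1] (mod n) \<or> [k = 1 + q] (mod n) \<or> [gcd q n * r = 0] (mod n) \<or> [gcd q n * s = 0] (mod n))"

definition type_Z_tilde :: "nat \<Rightarrow> nat \<Rightarrow> nat \<Rightarrow> nat \<Rightarrow> nat \<Rightarrow> bool" where
  "type_Z_tilde r n k s q \<longleftrightarrow>
    [int q * (int r - int s) = 2 * (int k - 1)] (mod int n) \<or>
    [int q * (int r + int s) = 0] (mod int n)"

end

theory Submission
  imports Defs "HOL-Computational_Algebra.Polynomial"
begin

text \<open>
  Let \<open>C\<close> be the cyclic group of order \<open>n\<close>. The abelianisation of \<open>P(r,n,k,s,q)\<close> is the
  additive group of \<open>\<int>[C] / (f)\<close>, where \<open>f\<close> is the image of the defining word: each \<open>x\<^sub>i\<close>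
  becomes \<open>X\<^sup>i\<close>, and the shift becomes multiplication by \<open>X\<close>. So the group is perfect exactly
  if \<open>f\<close> is a unit of the integral group ring \<open>\<int>[C]\<close>. Only the direction from perfect to unit
  matters here (\<open>perfect_prishchepov_unit\<close>).

  Units of \<open>\<int>[C]\<close> are rigid. Let \<open>*\<close> be the involution that inverts group elements. If
  \<open>u f = 1\<close>, then \<open>v = u f*\<close> satisfies \<open>v v* = 1\<close>. The coefficient of the identity in \<open>v v*\<close>
  is the sum of the squares of the integer coefficients of \<open>v\<close>, hence \<open>v\<close> is, up to sign, a single
  group element (\<open>unitary_imp_monom\<close>). As \<open>f* = v f\<close> and \<open>f\<close>, \<open>f*\<close> have the same nonzero
  augmentation, \<open>f* = X\<^sup>c f\<close> for some \<open>c\<close> (\<open>unit_star_associate\<close>): a unit is symmetric up to a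
  shift.

  The augmentation of \<open>f\<close> is \<open>r - s\<close>, which therefore is \<open>1\<close> when \<open>r \<ge> s\<close>. Multiplication by
  \<open>X\<^sup>q - 1\<close> collapses the two geometric sums in \<open>f\<close>; with \<open>A = k - 1\<close> it gives
  \<open>g = X\<^bsup>rq\<^esup> + X\<^sup>A - 1 - X\<^bsup>A+sq\<^esup>\<close>,
  and the symmetry of \<open>f\<close> becomes \<open>X\<^sup>q g* = - X\<^sup>c g\<close>. If a positive and a negative term of \<open>g\<close>
  cancel modulo \<open>n\<close>, then one of \<open>rq\<close>, \<open>sq\<close>, \<open>A\<close>, \<open>A - q\<close> vanishes modulo \<open>n\<close>, which is trivial
  perfection. Otherwise the two positive terms on the left must be the two positive terms on the
  right, in one of two orders (\<open>four_term_cong\<close>); eliminating \<open>c\<close>, the two orders give the two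
  congruences of type Z modulo \<open>n\<close>. These pass to every divisor of \<open>n\<close>, in particular to \<open>M\<close>.
\<close>

section \<open>Homomorphisms out of presentations of perfect groups\<close>

lemma hom_list_prod:
  assumes "group G" "group H" "h \<in> hom G H" "set xs \<subseteq> carrier G"
  shows "h (list_prod G xs) = list_prod H (map h xs)"
  using assms(4)
proof (induction xs)
  case Nil
  then show ?case using hom_one[OF assms(3,1,2)] by (simp add: list_prod_def)
next
  case (Cons x xs)
  then have "list_prod G xs \<in> carrier G"
    using group.list_prod_closed[OF assms(1)] by simp
  then show ?case
    using Cons hom_mult[OF assms(3)] by (simp add: list_prod_def)
qed

lemma perfect_group_derived:
  assumes "group G" "perfect_group G"
  shows "derived G (carrier G) = carrier G"
proof -
  interpret G: group G by fact
  let ?D = "derived G (carrier G)"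
  interpret D: normal ?D G
    by (rule G.derived_self_is_normal)
  have "a \<in> ?D" if a: "a \<in> carrier G" for a
  proof -
    have "?D #>\<^bsub>G\<^esub> a \<in> carrier (G Mod ?D)"
      using a by (auto simp: FactGroup_def RCOSETS_def)
    then have "?D #>\<^bsub>G\<^esub> a = ?D"
      using assms(2) by (simp add: perfect_group_def trivial_group_def)
    then show ?thesis
      using G.coset_join1 a D.subgroup_axioms by blast
  qed
  then show ?thesis
    using D.subset by blast
qed

text \<open>
  The image of \<open>N\<close> in \<open>F Mod K\<close> is a subgroup that contains all commutators, hence is everything;
  as \<open>N\<close> contains the kernel \<open>K\<close> of the projection, \<open>N\<close> is everything too.
\<close>

lemma perfect_quotient_subgroup:
  assumes "group F" "K \<lhd> F" "perfect_group (F Mod K)" "subgroup N F" "K \<subseteq> N"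
    and comm: "derived_set F (carrier F) \<subseteq> N"
  shows "N = carrier F"
proof -
  interpret F: group F by fact
  interpret K: normal K F by fact
  interpret Q: group "F Mod K" by (rule K.factorgroup_is_group)
  let ?p = "\<lambda>a. K #>\<^bsub>F\<^esub> a"
  interpret p: group_hom F "F Mod K" ?p
    using K.r_coset_hom_Mod by unfold_locales
  have N: "N \<subseteq> carrier F" by (rule subgroup.subset[OF assms(4)])
  have carr: "carrier (F Mod K) = ?p ` carrier F"
    by (auto simp: FactGroup_def RCOSETS_def)
  have "derived_set (F Mod K) (carrier (F Mod K)) \<subseteq> ?p ` N"
  proof
    fix z assume "z \<in> derived_set (F Mod K) (carrier (F Mod K))"
    then obtain a b where ab: "a \<in> carrier F" "b \<in> carrier F"
      and z: "z = ?p a \<otimes>\<^bsub>F Mod K\<^esub> ?p b \<otimes>\<^bsub>F Mod K\<^esub> inv\<^bsub>F Mod K\<^esub> ?p a \<otimes>\<^bsub>F Mod K\<^esub> inv\<^bsub>F Mod K\<^esub> ?p b"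
      unfolding carr by blast
    have "z = ?p (a \<otimes>\<^bsub>F\<^esub> b \<otimes>\<^bsub>F\<^esub> inv\<^bsub>F\<^esub> a \<otimes>\<^bsub>F\<^esub> inv\<^bsub>F\<^esub> b)"
      using ab by (simp only: z p.hom_mult p.hom_inv F.m_closed F.inv_closed)
    moreover have "a \<otimes>\<^bsub>F\<^esub> b \<otimes>\<^bsub>F\<^esub> inv\<^bsub>F\<^esub> a \<otimes>\<^bsub>F\<^esub> inv\<^bsub>F\<^esub> b \<in> N"
      using comm ab by blast
    ultimately show "z \<in> ?p ` N" by blast
  qed
  then have "derived (F Mod K) (carrier (F Mod K)) \<subseteq> ?p ` N"
    unfolding derived_def
    by (rule Q.generate_subgroup_incl) (rule p.subgroup_img_is_subgroup[OF assms(4)])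
  then have all: "?p ` carrier F \<subseteq> ?p ` N"
    using perfect_group_derived[OF K.factorgroup_is_group assms(3)] carr by simp
  have "a \<in> N" if a: "a \<in> carrier F" for a
  proof -
    obtain b where b: "b \<in> N" "?p a = ?p b" using all a by blast
    have "a \<in> K #>\<^bsub>F\<^esub> b"
      using F.rcos_self[OF a K.subgroup_axioms] b by simp
    then obtain t where "t \<in> K" "a = t \<otimes>\<^bsub>F\<^esub> b"
      by (auto simp: r_coset_def)
    then show ?thesis
      using assms(5) b subgroup.m_closed[OF assms(4)] by blast
  qed
  then show ?thesis using N by blast
qed

text \<open>
  This is the only use of perfectness: modulo \<open>S\<close>, the map \<open>h\<close> is a homomorphism from the presented
  group to an abelian group, so it is trivial. The quotient of \<open>H\<close> by \<open>S\<close> is avoided by looking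
  at the preimage of \<open>S\<close> under \<open>h\<close>.
\<close>

lemma perfect_presentation_hom:
  assumes "R \<subseteq> carrier (free_group X)" "perfect_group (presented_group X R)"
    and "comm_group H" "h \<in> hom (free_group X) H" "subgroup S H" "h ` R \<subseteq> S"
    and "a \<in> carrier (free_group X)"
  shows "h a \<in> S"
proof -
  let ?F = "free_group X"
  interpret F: group ?F by (rule group_free_group)
  interpret H: comm_group H by fact
  interpret h: group_hom ?F H h using assms(4) by unfold_locales
  interpret S: subgroup S H by fact
  let ?N = "{a \<in> carrier ?F. h a \<in> S}"
  have sub: "subgroup ?N ?F"
    by (rule F.subgroupI) (auto intro: exI[of _ "\<one>\<^bsub>?F\<^esub>"])
  have "?N \<lhd> ?F"
  proof (rule F.normal_invI[OF sub])
    fix x y assume "x \<in> carrier ?F" "y \<in> ?N"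
    moreover from this have "h x \<otimes>\<^bsub>H\<^esub> h y \<otimes>\<^bsub>H\<^esub> inv\<^bsub>H\<^esub> h x = h y"
      by (simp add: H.m_comm[of "h x" "h y"] H.m_assoc)
    ultimately show "x \<otimes>\<^bsub>?F\<^esub> y \<otimes>\<^bsub>?F\<^esub> inv\<^bsub>?F\<^esub> x \<in> ?N"
      by simp
  qed
  then have K: "normal_closure ?F R \<subseteq> ?N"
    using assms(1,6) unfolding normal_closure_def by blast
  have "derived_set ?F (carrier ?F) \<subseteq> ?N"
  proof
    fix z assume "z \<in> derived_set ?F (carrier ?F)"
    then obtain a b where ab: "a \<in> carrier ?F" "b \<in> carrier ?F"
      and z: "z = a \<otimes>\<^bsub>?F\<^esub> b \<otimes>\<^bsub>?F\<^esub> inv\<^bsub>?F\<^esub> a \<otimes>\<^bsub>?F\<^esub> inv\<^bsub>?F\<^esub> b" by blast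
    have "h z = \<one>\<^bsub>H\<^esub>"
      using ab by (simp add: z H.m_comm[of "h a" "h b"] H.m_assoc)
    then show "z \<in> ?N" using ab z by simp
  qed
  then have "?N = carrier ?F"
    using perfect_quotient_subgroup[OF group_free_group F.normal_closure_normal[OF assms(1)] _ sub K]
      assms(2) by (simp add: presented_group_def)
  then show ?thesis using assms(7) by blast
qed

section \<open>The integral group ring of a cyclic group\<close>

text \<open>
  Polynomials stand for elements of the group ring \<open>\<int>[C] = \<int>[X] / (X\<^sup>n - 1)\<close>, and
  \<open>cyc_cong n\<close> is equality there. A congruence is used because the modulus
  depends on the variable \<open>n\<close>, so that the quotient ring is not a type.
\<close>

definition cyc_cong :: "nat \<Rightarrow> int poly \<Rightarrow> int poly \<Rightarrow> bool"
  where "cyc_cong n a b \<longleftrightarrow> monom 1 n - 1 dvd a - b"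

lemma cyc_cong_refl [simp]: "cyc_cong n a a"
  by (simp add: cyc_cong_def)

lemma cyc_cong_sym: "cyc_cong n a b \<Longrightarrow> cyc_cong n b a"
  unfolding cyc_cong_def using dvd_minus_iff[of "monom 1 n - 1" "a - b"] by simp

lemma cyc_cong_add:
  assumes "cyc_cong n a b" "cyc_cong n c d" shows "cyc_cong n (a + c) (b + d)"
proof -
  have "a + c - (b + d) = (a - b) + (c - d)" by simp
  then show ?thesis using assms unfolding cyc_cong_def by (metis dvd_add)
qed

lemma cyc_cong_diff:
  assumes "cyc_cong n a b" "cyc_cong n c d" shows "cyc_cong n (a - c) (b - d)"
proof -
  have "a - c - (b - d) = (a - b) - (c - d)" by simp
  then show ?thesis using assms unfolding cyc_cong_def by (metis dvd_diff)
qed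

lemma cyc_cong_trans [trans]:
  assumes "cyc_cong n a b" "cyc_cong n b c" shows "cyc_cong n a c"
  using cyc_cong_add[OF assms] by (simp add: cyc_cong_def)

lemma cyc_cong_mult:
  assumes "cyc_cong n a b" "cyc_cong n c d" shows "cyc_cong n (a * c) (b * d)"
proof -
  have "a * c - b * d = (a - b) * c + b * (c - d)" by (simp add: algebra_simps)
  moreover have "monom 1 n - 1 dvd (a - b) * c" "monom 1 n - 1 dvd b * (c - d)"
    using assms by (simp_all add: cyc_cong_def)
  ultimately show ?thesis unfolding cyc_cong_def by (metis dvd_add)
qed

lemma cyc_cong_sum:
  "(\<And>i. i \<in> I \<Longrightarrow> cyc_cong n (f i) (g i)) \<Longrightarrow> cyc_cong n (\<Sum>i\<in>I. f i) (\<Sum>i\<in>I. g i)"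
  by (induction I rule: infinite_finite_induct) (auto intro: cyc_cong_add)

lemma cyc_cong_poly_1:
  assumes "cyc_cong n a b" shows "poly a 1 = poly b 1"
proof -
  obtain t where "a - b = (monom 1 n - 1) * t"
    using assms unfolding cyc_cong_def by (rule dvdE)
  then have "poly (a - b) 1 = poly ((monom 1 n - 1) * t) 1" by (rule arg_cong)
  then show ?thesis by (simp add: poly_monom)
qed

lemma cyc_cong_monom_mult: "cyc_cong n (monom c (a * n)) [:c:]"
proof -
  have "monom 1 n - 1 dvd (monom 1 n) ^ a - (1 :: int poly)"
    using power_diff_1_eq[of "monom 1 n :: int poly" a] by simp
  then have "monom 1 n - 1 dvd [:c:] * ((monom 1 n) ^ a - (1 :: int poly))"
    by (rule dvd_mult)
  then show ?thesis
    unfolding cyc_cong_def by (simp add: monom_power algebra_simps smult_monom)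
qed

lemma cyc_cong_monom:
  assumes "[a = b] (mod n)"
  shows "cyc_cong n (monom c a) (monom c b)"
proof -
  have *: "cyc_cong n (monom c i) (monom c (i mod n))" for i
  proof -
    have "cyc_cong n (monom c (i div n * n) * monom 1 (i mod n)) ([:c:] * monom 1 (i mod n))"
      by (intro cyc_cong_mult cyc_cong_monom_mult cyc_cong_refl)
    then show ?thesis by (simp add: mult_monom smult_monom)
  qed
  show ?thesis
    using *[of a] *[of b] assms by (metis cong_def cyc_cong_sym cyc_cong_trans)
qed

text \<open>
  Coefficients in the group ring are well defined: together with \<open>cyc_cong_monom\<close>, which reduces
  exponents modulo \<open>n\<close>, this lemma turns congruences into equations between coefficients.
\<close>

lemma cyc_cong_imp_eq:
  assumes "cyc_cong n a b" "degree a < n" "degree b < n"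
  shows "a = b"
proof (rule ccontr)
  assume "a \<noteq> b"
  have "degree (monom 1 n - 1 :: int poly) = n"
    using assms degree_add_eq_left[of "- 1" "monom 1 n :: int poly"] by (simp add: degree_monom_eq)
  then have "n \<le> degree (a - b)"
    using assms(1) \<open>a \<noteq> b\<close> dvd_imp_degree_le[of "monom 1 n - 1" "a - b"]
    by (simp add: cyc_cong_def)
  then show False
    using degree_diff_less[OF assms(2,3)] by simp
qed

lemma cyc_cong_reduced:
  assumes "n \<ge> 1"
  obtains v :: "nat \<Rightarrow> int" where "cyc_cong n p (\<Sum>i<n. monom (v i) i)"
proof -
  have "\<exists>v :: nat \<Rightarrow> int. cyc_cong n p (\<Sum>i<n. monom (v i) i)"
  proof (rule exI)
    let ?v = "\<lambda>i. \<Sum>j | j \<le> degree p \<and> j mod n = i. coeff p j"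
    have "p = (\<Sum>j\<le>degree p. monom (coeff p j) j)"
      by (simp add: poly_as_sum_of_monoms)
    also have "cyc_cong n \<dots> (\<Sum>j\<le>degree p. monom (coeff p j) (j mod n))"
      by (intro cyc_cong_sum cyc_cong_monom) (simp add: cong_def)
    also have "(\<Sum>j\<le>degree p. monom (coeff p j) (j mod n))
        = (\<Sum>i<n. \<Sum>j | j \<in> {..degree p} \<and> j mod n = i. monom (coeff p j) (j mod n))"
      by (rule sum.group[symmetric]) (use assms in auto)
    also have "\<dots> = (\<Sum>i<n. monom (?v i) i)"
      by (intro sum.cong refl) (auto simp: monom_sum intro!: sum.cong)
    finally show "cyc_cong n p (\<Sum>i<n. monom (?v i) i)" .
  qed
  then show ?thesis using that by blast
qed

text \<open>
  The involution of the group ring that inverts group elements. Substituting \<open>X\<^bsup>n-1\<^esup>\<close>, which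
  represents the inverse of \<open>X\<close>, keeps it inside the polynomials; it is an involution only up to
  \<open>cyc_cong n\<close>.
\<close>

definition cyc_star :: "nat \<Rightarrow> int poly \<Rightarrow> int poly"
  where "cyc_star n p = pcompose p (monom 1 (n - 1))"

lemma cyc_star_monom: "cyc_star n (monom c a) = monom c ((n - 1) * a)"
  by (induction a) (simp_all add: cyc_star_def monom_0 monom_Suc pcompose_pCons mult_monom)

lemma cyc_star_cong:
  assumes "cyc_cong n a b"
  shows "cyc_cong n (cyc_star n a) (cyc_star n b)"
proof -
  obtain t where "a - b = (monom 1 n - 1) * t"
    using assms by (auto simp: cyc_cong_def)
  then have "cyc_star n a - cyc_star n b = cyc_star n (monom 1 n - 1) * cyc_star n t"
    unfolding cyc_star_def by (simp flip: pcompose_diff pcompose_mult)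
  moreover have "cyc_star n (monom 1 n - 1) = monom 1 ((n - 1) * n) - 1"
    using cyc_star_monom[of n 1 n] by (simp add: cyc_star_def pcompose_diff pcompose_1)
  moreover have "monom 1 n - 1 dvd monom 1 ((n - 1) * n) - (1 :: int poly)"
    using cyc_cong_monom_mult[of n 1 "n - 1"] by (simp add: cyc_cong_def one_pCons)
  ultimately show ?thesis
    by (simp add: cyc_cong_def)
qed

lemma cyc_star_mult: "cyc_star n (a * b) = cyc_star n a * cyc_star n b"
  by (simp add: cyc_star_def pcompose_mult)

lemma cyc_star_add: "cyc_star n (a + b) = cyc_star n a + cyc_star n b"
  by (simp add: cyc_star_def pcompose_add)

lemma cyc_star_diff: "cyc_star n (a - b) = cyc_star n a - cyc_star n b"
  by (simp add: cyc_star_def pcompose_diff)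

lemma cyc_star_1: "cyc_star n 1 = 1"
  by (simp add: cyc_star_def pcompose_1)

lemma cyc_star_sum: "cyc_star n (sum f A) = (\<Sum>i\<in>A. cyc_star n (f i))"
  by (simp add: cyc_star_def pcompose_sum)

lemma cong_nat_negate:
  assumes "n \<ge> 1" shows "[int ((n - 1) * a) = - int a] (mod int n)"
proof -
  have "int ((n - 1) * a) - (- int a) = int n * int a"
    using assms by (simp add: of_nat_diff algebra_simps)
  then show ?thesis by (simp add: cong_iff_dvd_diff)
qed

lemma cyc_star_star:
  assumes "n \<ge> 1" shows "cyc_cong n (cyc_star n (cyc_star n p)) p"
proof -
  have *: "[(n - 1) * ((n - 1) * j) = j] (mod n)" for j
  proof -
    have "[int ((n - 1) * ((n - 1) * j)) = - int ((n - 1) * j)] (mod int n)"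
      by (rule cong_nat_negate[OF assms])
    also have "[- int ((n - 1) * j) = - (- int j)] (mod int n)"
      by (subst cong_minus_minus_iff) (rule cong_nat_negate[OF assms])
    finally show ?thesis by (simp flip: cong_int_iff)
  qed
  have "cyc_star n (cyc_star n p) = cyc_star n (cyc_star n (\<Sum>j\<le>degree p. monom (coeff p j) j))"
    by (simp add: poly_as_sum_of_monoms)
  also have "\<dots> = (\<Sum>j\<le>degree p. monom (coeff p j) ((n - 1) * ((n - 1) * j)))"
    by (simp add: cyc_star_sum cyc_star_monom)
  also have "cyc_cong n \<dots> (\<Sum>j\<le>degree p. monom (coeff p j) j)"
    by (intro cyc_cong_sum cyc_cong_monom *)
  finally show ?thesis by (simp add: poly_as_sum_of_monoms)
qed

text \<open>
  In the reduced form \<open>\<Sum>i<n. v\<^sub>i X\<^sup>i\<close> of \<open>p\<close>, the constant coefficient of \<open>p p*\<close> is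
  \<open>\<Sum>i<n. v\<^sub>i\<^sup>2\<close>. A sum of integer squares equal to \<open>1\<close> has a single nonzero term.
\<close>

lemma unitary_imp_monom:
  assumes n: "n \<ge> 1" and p: "cyc_cong n (p * cyc_star n p) 1"
  obtains c \<epsilon> where "\<epsilon> = 1 \<or> \<epsilon> = -1" "cyc_cong n p (monom \<epsilon> c)"
proof -
  obtain v where v: "cyc_cong n p (\<Sum>i<n. monom (v i) i)"
    using cyc_cong_reduced[OF n] by blast
  let ?e = "\<lambda>i j. (i + (n - 1) * j) mod n"
  let ?P = "\<Sum>i<n. \<Sum>j<n. monom (v i * v j) (?e i j)"
  have "cyc_cong n 1 (p * cyc_star n p)"
    using p by (rule cyc_cong_sym)
  also have "cyc_cong n \<dots> ((\<Sum>i<n. monom (v i) i) * cyc_star n (\<Sum>i<n. monom (v i) i))"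
    by (intro cyc_cong_mult cyc_star_cong v)
  also have "\<dots> = (\<Sum>i<n. \<Sum>j<n. monom (v i * v j) (i + (n - 1) * j))"
    by (simp add: cyc_star_sum cyc_star_monom sum_product mult_monom)
  also have "cyc_cong n \<dots> ?P"
    by (intro cyc_cong_sum cyc_cong_monom) (simp add: cong_def)
  finally have "1 = ?P"
  proof (rule cyc_cong_imp_eq)
    show "degree ?P < n"
      using n by (intro degree_sum_less le_less_trans[OF degree_monom_le]) auto
  qed (use n in simp)
  then have "coeff ?P 0 = 1"
    using arg_cong[of 1 ?P "\<lambda>p. coeff p 0"] by simp
  moreover have "coeff ?P 0 = (\<Sum>i<n. \<Sum>j<n. if i = j then v i * v j else 0)"
  proof -
    have "?e i j = 0 \<longleftrightarrow> i = j" if "i < n" "j < n" for i j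
    proof -
      have "?e i j = 0 \<longleftrightarrow> [int i + int ((n - 1) * j) = 0] (mod int n)"
        by (metis cong_0_iff cong_int_iff dvd_eq_mod_eq_0 of_nat_0 of_nat_add)
      also have "\<dots> \<longleftrightarrow> [int i + - int j = 0] (mod int n)"
        using cong_add[OF cong_refl[of "int i"] cong_nat_negate[OF n, of j]]
        by (meson cong_sym cong_trans)
      also have "\<dots> \<longleftrightarrow> [int i = int j] (mod int n)"
        unfolding cong_iff_dvd_diff by simp
      also have "\<dots> \<longleftrightarrow> i = j"
        using that by (metis cong_int_iff cong_less_modulus_unique_nat cong_refl)
      finally show ?thesis .
    qed
    then show ?thesis
      by (simp add: coeff_sum)
  qed
  ultimately have sq: "(\<Sum>i<n. (v i)\<^sup>2) = 1"
    by (simp add: power2_eq_square)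
  obtain c where c: "c < n" "v c \<noteq> 0"
  proof (rule ccontr)
    assume "\<not> thesis"
    then have "(\<Sum>i<n. (v i)\<^sup>2) = 0" using that by (intro sum.neutral) auto
    then show False using sq by simp
  qed
  have split: "(v c)\<^sup>2 + (\<Sum>i\<in>{..<n} - {c}. (v i)\<^sup>2) = 1"
    using sq sum.remove[of "{..<n}" c "\<lambda>i. (v i)\<^sup>2"] c by simp
  moreover have "(v c)\<^sup>2 > 0" "(\<Sum>i\<in>{..<n} - {c}. (v i)\<^sup>2) \<ge> 0"
    using c by (auto intro: sum_nonneg)
  ultimately have vc: "(v c)\<^sup>2 = 1" and rest: "(\<Sum>i\<in>{..<n} - {c}. (v i)\<^sup>2) = 0"
    by linarith+
  have "v i = 0" if "i \<in> {..<n} - {c}" for i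
    using rest that by (subst (asm) sum_nonneg_eq_0_iff) auto
  then have "(\<Sum>i\<in>{..<n} - {c}. monom (v i) i) = 0"
    by (simp add: sum.neutral)
  then have "(\<Sum>i<n. monom (v i) i) = monom (v c) c"
    using sum.remove[of "{..<n}" c "\<lambda>i. monom (v i) i"] c by simp
  moreover have "v c = 1 \<or> v c = -1"
    using vc by (simp add: power2_eq_1_iff)
  ultimately show ?thesis
    using that[of "v c" c] v by simp
qed

text \<open>
  The element \<open>u f*\<close> is unitary, since \<open>(u f*) (u f*)* = (u f)* (u f)\<close>, and it carries \<open>f\<close> to
  \<open>f*\<close>. The sign of the resulting monomial is positive because \<open>f\<close> and \<open>f*\<close> have the same value
  at \<open>1\<close>, and that value divides \<open>1\<close>.
\<close>

lemma unit_star_associate: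
  assumes n: "n \<ge> 1" and u: "cyc_cong n (u * f) 1"
  obtains c where "cyc_cong n (cyc_star n f) (monom 1 c * f)"
proof -
  let ?s = "cyc_star n"
  let ?v = "u * ?s f"
  have us: "cyc_cong n (?s u * ?s f) 1"
    using cyc_star_cong[OF u] by (simp add: cyc_star_mult cyc_star_1)
  have "?v * ?s ?v = (?s u * ?s f) * (u * ?s (?s f))"
    by (simp add: cyc_star_mult algebra_simps)
  also have "cyc_cong n \<dots> (1 * (u * f))"
    by (intro cyc_cong_mult us cyc_cong_refl cyc_star_star n)
  also have "cyc_cong n (1 * (u * f)) 1"
    using u by simp
  finally obtain c \<epsilon> where e: "\<epsilon> = 1 \<or> \<epsilon> = -1" and c: "cyc_cong n ?v (monom \<epsilon> c)"
    using unitary_imp_monom[OF n] by blast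
  have "cyc_cong n (1 * ?s f) ((u * f) * ?s f)"
    by (intro cyc_cong_mult cyc_cong_refl cyc_cong_sym[OF u])
  also have "(u * f) * ?s f = ?v * f" by (simp add: algebra_simps)
  also have "cyc_cong n \<dots> (monom \<epsilon> c * f)"
    by (intro cyc_cong_mult cyc_cong_refl c)
  finally have *: "cyc_cong n (?s f) (monom \<epsilon> c * f)" by simp
  have "poly f 1 \<noteq> 0"
    using cyc_cong_poly_1[OF u] by auto
  moreover have "poly (?s f) 1 = poly f 1"
    by (simp add: cyc_star_def poly_pcompose poly_monom)
  ultimately have "\<epsilon> = 1"
    using cyc_cong_poly_1[OF *] by (simp add: poly_monom)
  then show ?thesis using * that by simp
qed

text \<open>
  Without cancellation on either side, the exponents with coefficient \<open>+1\<close> can be read off from the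
  positive coefficients in the group ring.
\<close>

lemma four_term_cong:
  assumes n: "n \<ge> 1"
    and eq: "cyc_cong n (monom 1 a1 + monom 1 a2 - monom 1 b1 - monom 1 b2)
               (monom 1 c1 + monom 1 c2 - monom 1 d1 - monom 1 d2)"
    and "\<not> [a1 = b1] (mod n)" "\<not> [a1 = b2] (mod n)" "\<not> [a2 = b1] (mod n)" "\<not> [a2 = b2] (mod n)"
    and "\<not> [c1 = d1] (mod n)" "\<not> [c1 = d2] (mod n)" "\<not> [c2 = d1] (mod n)" "\<not> [c2 = d2] (mod n)"
  shows "[a1 = c1] (mod n) \<and> [a2 = c2] (mod n) \<or> [a1 = c2] (mod n) \<and> [a2 = c1] (mod n)"
proof -
  have red: "cyc_cong n (monom 1 e) (monom 1 (e mod n))" for e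
    by (rule cyc_cong_monom) (simp add: cong_def)
  have "cyc_cong n (monom 1 (a1 mod n) + monom 1 (a2 mod n) - monom 1 (b1 mod n) - monom 1 (b2 mod n))
      (monom 1 a1 + monom 1 a2 - monom 1 b1 - monom 1 b2)"
    by (intro cyc_cong_add cyc_cong_diff cyc_cong_sym[OF red])
  also note eq
  also have "cyc_cong n (monom 1 c1 + monom 1 c2 - monom 1 d1 - monom 1 d2)
      (monom 1 (c1 mod n) + monom 1 (c2 mod n) - monom 1 (d1 mod n) - monom 1 (d2 mod n))"
    by (intro cyc_cong_add cyc_cong_diff red)
  finally have E: "monom 1 (a1 mod n) + monom 1 (a2 mod n) - monom 1 (b1 mod n) - monom 1 (b2 mod n)
      = monom 1 (c1 mod n) + monom 1 (c2 mod n) - monom 1 (d1 mod n) - monom (1::int) (d2 mod n)"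
    by (rule cyc_cong_imp_eq)
      (use n in \<open>auto intro!: degree_add_less degree_diff_less le_less_trans[OF degree_monom_le]\<close>)
  have co: "(if a1 mod n = i then 1 else 0) + (if a2 mod n = i then 1 else 0)
        + (if d1 mod n = i then 1 else 0) + (if d2 mod n = i then 1 else 0)
      = (if c1 mod n = i then 1 else 0) + (if c2 mod n = i then 1 else 0)
        + (if b1 mod n = i then 1 else 0) + (if b2 mod n = i then 1 else (0::int))" for i
    using arg_cong[OF E, of "\<lambda>p. coeff p i"] by simp
  note ne = assms(3-)[unfolded cong_def]
  have "a1 mod n = c1 mod n \<or> a1 mod n = c2 mod n"
    using co[of "a1 mod n"] ne(1,2) by (simp split: if_splits)
  moreover have "a2 mod n = c1 mod n \<or> a2 mod n = c2 mod n"
    using co[of "a2 mod n"] ne(3,4) by (simp split: if_splits)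
  moreover have "c1 mod n = a1 mod n \<or> c1 mod n = a2 mod n"
    using co[of "c1 mod n"] ne(5,6) by (simp split: if_splits)
  moreover have "c2 mod n = a1 mod n \<or> c2 mod n = a2 mod n"
    using co[of "c2 mod n"] ne(7,8) by (simp split: if_splits)
  ultimately show ?thesis unfolding cong_def by argo
qed

section \<open>Perfect Prishchepov groups\<close>

definition int_poly_group :: "int poly monoid"
  where "int_poly_group = \<lparr>carrier = UNIV, monoid.mult = (+), one = 0\<rparr>"

lemma comm_group_int_poly_group: "comm_group int_poly_group"
proof (rule comm_groupI)
  fix x :: "int poly"
  show "\<exists>y\<in>carrier int_poly_group. y \<otimes>\<^bsub>int_poly_group\<^esub> x = \<one>\<^bsub>int_poly_group\<^esub>"
    by (rule bexI[of _ "- x"]) (simp_all add: int_poly_group_def)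
qed (simp_all add: int_poly_group_def algebra_simps)

lemma int_poly_group_inv: "inv\<^bsub>int_poly_group\<^esub> x = - x"
proof -
  interpret comm_group int_poly_group by (rule comm_group_int_poly_group)
  show ?thesis by (rule inv_equality) (simp_all add: int_poly_group_def)
qed

lemma int_poly_group_list_prod: "list_prod int_poly_group xs = sum_list xs"
  by (induction xs) (simp_all add: list_prod_def int_poly_group_def)

text \<open>
  The image of the defining word in the group ring, where the generator \<open>x\<^sub>i\<close> becomes \<open>X\<^sup>i\<close>. The
  exponents are not reduced, so the polynomial does not depend on \<open>n\<close>.
\<close>

definition prishchepov_poly :: "nat \<Rightarrow> nat \<Rightarrow> nat \<Rightarrow> nat \<Rightarrow> int poly" where
  "prishchepov_poly r k s q = (\<Sum>i<r. monom 1 (i * q)) - (\<Sum>i<s. monom 1 (k - 1 + i * q))"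

lemma shift_aut_funpow_prishchepov_word:
  assumes "n \<ge> 1"
  shows "(shift_aut n ^^ j) (prishchepov_word r n k s q) =
    list_prod (cyc_free_group n) (map (\<lambda>i. cyc_gen n (i * q + j)) [0..<r])
    \<otimes>\<^bsub>cyc_free_group n\<^esub>
    inv\<^bsub>cyc_free_group n\<^esub>
      list_prod (cyc_free_group n) (map (\<lambda>i. cyc_gen n (k - 1 + i * q + j)) [0..<s])"
proof -
  let ?F = "cyc_free_group n"
  interpret F: group ?F by (rule group_free_group)
  interpret h: group_hom ?F ?F "shift_aut n ^^ j"
    using shift_aut_funpow_hom[OF assms] by unfold_locales
  have gens: "set (map (\<lambda>i. cyc_gen n (e i)) xs) \<subseteq> carrier ?F" for e :: "nat \<Rightarrow> nat" and xs
    using cyc_gen_closed[OF assms] by auto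
  have "(shift_aut n ^^ j) (list_prod ?F (map (\<lambda>i. cyc_gen n (e i)) xs))
      = list_prod ?F (map (\<lambda>i. cyc_gen n (e i + j)) xs)" for e :: "nat \<Rightarrow> nat" and xs
    using hom_list_prod[OF group_free_group group_free_group h.homh gens]
    by (simp add: o_def shift_aut_funpow_gen[OF assms])
  then show ?thesis
    using F.list_prod_closed[OF gens]
    by (simp add: prishchepov_word_def h.hom_inv)
qed

text \<open>
  Sending \<open>x\<^sub>i\<close> to \<open>X\<^sup>i\<close> maps the \<open>j\<close>-th shift of the defining word to \<open>X\<^sup>j f\<close>, hence every
  relator into the ideal generated by \<open>f\<close>. For a perfect group the ideal then contains the
  image \<open>1\<close> of \<open>x\<^sub>0\<close>.
\<close>

lemma perfect_prishchepov_unit: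
  assumes n: "n \<ge> 1" and perf: "perfect_group (prishchepov r n k s q)"
  obtains u where "cyc_cong n (u * prishchepov_poly r k s q) 1"
proof -
  let ?F = "cyc_free_group n" and ?H = int_poly_group
  let ?f = "prishchepov_poly r k s q"
  let ?w = "prishchepov_word r n k s q"
  define h where "h = free_lift ?H (\<lambda>i::nat. monom 1 i)"
  interpret F: group ?F by (rule group_free_group)
  interpret H: comm_group ?H by (rule comm_group_int_poly_group)
  have gens: "(\<lambda>i::nat. monom 1 i) \<in> {..<n} \<rightarrow> carrier ?H"
    by (simp add: int_poly_group_def)
  interpret h: group_hom ?F ?H h
    using H.free_lift_hom[OF gens] by unfold_locales (simp add: h_def)
  have h_gen: "h (cyc_gen n i) = monom 1 (i mod n)" for i
    using H.free_lift_gen[OF gens, of "i mod n"] n by (simp add: h_def cyc_gen_def)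
  have gen_list: "set (map (\<lambda>i. cyc_gen n (e i)) xs) \<subseteq> carrier ?F" for e :: "nat \<Rightarrow> nat" and xs
    using cyc_gen_closed[OF n] by auto
  have h_prod: "h (list_prod ?F (map (\<lambda>i. cyc_gen n (e i)) [0..<t])) = (\<Sum>i<t. monom 1 (e i mod n))"
    for e :: "nat \<Rightarrow> nat" and t
    using hom_list_prod[OF group_free_group H.is_group h.homh gen_list]
    by (simp add: o_def h_gen int_poly_group_list_prod interv_sum_list_conv_sum_set_nat atLeast0LessThan)
  have relator: "cyc_cong n (h ((shift_aut n ^^ j) ?w)) (monom 1 j * ?f)" for j
  proof -
    have "h ((shift_aut n ^^ j) ?w)
        = (\<Sum>i<r. monom 1 ((i * q + j) mod n)) - (\<Sum>i<s. monom 1 ((k - 1 + i * q + j) mod n))"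
      using F.list_prod_closed[OF gen_list]
      by (simp add: shift_aut_funpow_prishchepov_word[OF n] h.hom_inv int_poly_group_inv h_prod)
        (simp add: int_poly_group_def)
    also have "cyc_cong n \<dots>
        ((\<Sum>i<r. monom 1 (i * q + j)) - (\<Sum>i<s. monom 1 (k - 1 + i * q + j)))"
      by (intro cyc_cong_diff cyc_cong_sum cyc_cong_monom) (simp_all add: cong_def)
    also have "\<dots> = monom 1 j * ?f"
      by (simp add: prishchepov_poly_def right_diff_distrib sum_distrib_left mult_monom add.commute)
    finally show ?thesis .
  qed
  let ?S = "{p. \<exists>u. cyc_cong n p (u * ?f)}"
  have S: "subgroup ?S ?H"
  proof (rule H.subgroupI)
    show "?S \<noteq> {}" using cyc_cong_refl by blast
    fix a assume "a \<in> ?S"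
    then obtain u where u: "cyc_cong n a (u * ?f)" by blast
    have "cyc_cong n (- a) (- u * ?f)"
      using cyc_cong_diff[OF cyc_cong_refl[of n 0] u] by simp
    then show "inv\<^bsub>?H\<^esub> a \<in> ?S"
      by (auto simp only: int_poly_group_inv)
    fix b assume "b \<in> ?S"
    then obtain v where v: "cyc_cong n b (v * ?f)" by blast
    have "cyc_cong n (a + b) ((u + v) * ?f)"
      using cyc_cong_add[OF u v] by (simp add: distrib_right)
    then show "a \<otimes>\<^bsub>?H\<^esub> b \<in> ?S"
      by (auto simp: int_poly_group_def)
  qed (simp add: int_poly_group_def)
  have w: "?w \<in> carrier ?F"
    unfolding prishchepov_word_def
    by (intro F.m_closed F.inv_closed F.list_prod_closed gen_list)
  have "h (cyc_gen n 0) \<in> ?S"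
  proof (rule perfect_presentation_hom[OF _ perf[unfolded prishchepov_def cyc_presented_def]
        comm_group_int_poly_group h.homh S])
    show "(\<lambda>j. (shift_aut n ^^ j) ?w) ` {..<n} \<subseteq> carrier ?F"
      using w hom_in_carrier[OF shift_aut_funpow_hom[OF n]] by blast
    show "h ` (\<lambda>j. (shift_aut n ^^ j) ?w) ` {..<n} \<subseteq> ?S"
      using relator by blast
  qed (rule cyc_gen_closed[OF n])
  then obtain u where "cyc_cong n 1 (u * ?f)"
    by (auto simp: h_gen)
  then show ?thesis
    using that cyc_cong_sym by blast
qed

lemma monom_geometric_sum:
  "(monom 1 q - 1) * (\<Sum>i<t. monom 1 (a + i * q)) = monom 1 (a + t * q) - monom (1::int) a"
  by (induction t) (simp_all add: algebra_simps mult_monom)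

lemma prishchepov_poly_four_terms:
  "(monom 1 q - 1) * prishchepov_poly r k s q
    = monom 1 (r * q) + monom 1 (k - 1) - monom 1 0 - monom 1 (k - 1 + s * q)"
  using monom_geometric_sum[of q 0 r] monom_geometric_sum[of q "k - 1" s]
  by (simp add: prishchepov_poly_def right_diff_distrib)

lemma cong_gcd_mult_iff:
  fixes q n t :: nat
  shows "[gcd q n * t = 0] (mod n) \<longleftrightarrow> [t * q = 0] (mod n)"
proof -
  have "n dvd t * q \<longleftrightarrow> n dvd gcd (t * q) (t * n)" by simp
  also have "\<dots> \<longleftrightarrow> n dvd gcd q n * t"
    by (simp add: gcd_mult_distrib_nat mult.commute)
  finally show ?thesis by (simp add: cong_0_iff)
qed

text \<open>
  The symmetry of the unit \<open>f\<close>, multiplied by \<open>X\<^sup>q - 1\<close>, is compared term by term.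
\<close>

theorem perfect_prishchepov_trivially_or_type_Z:
  assumes n: "n \<ge> 1" and k: "k \<ge> 1" and rs: "r \<ge> s"
    and perf: "perfect_group (prishchepov r n k s q)"
  shows "trivially_perfect r n k s q \<or> type_Z_tilde r n k s q"
proof (rule disj_imp[THEN iffD2], rule impI)
  assume not_triv: "\<not> trivially_perfect r n k s q"
  let ?f = "prishchepov_poly r k s q"
  define A where "A = k - 1"
  have kA: "k = A + 1" using k by (simp add: A_def)
  let ?neg = "\<lambda>a. (n - 1) * a"
  obtain u where u: "cyc_cong n (u * ?f) 1"
    using perfect_prishchepov_unit[OF n perf] by blast
  obtain c where c: "cyc_cong n (cyc_star n ?f) (monom 1 c * ?f)"
    using unit_star_associate[OF n u] by blast
  have "poly ?f 1 = int r - int s"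
    by (simp add: prishchepov_poly_def poly_sum poly_monom)
  then have "poly u 1 * (int r - int s) = 1"
    using cyc_cong_poly_1[OF u] by simp
  then have rs1: "int r - int s = 1"
    using rs by (simp add: pos_zmult_eq_1_iff zmult_eq_1_iff)
  then have r: "r = s + 1" by simp
  have nk: "\<not> [A = 0] (mod n)" "\<not> [A = q] (mod n)" "\<not> [r * q = 0] (mod n)" "\<not> [s * q = 0] (mod n)"
    using not_triv rs1 cong_add_rcancel_nat[of A 1 0 n] cong_add_rcancel_nat[of A 1 q n]
    by (auto simp: trivially_perfect_def cong_gcd_mult_iff kA add.commute)
  have neg: "[int (?neg a) = - int a] (mod int n)" for a
    by (rule cong_nat_negate[OF n])
  let ?g = "\<lambda>e1 e2 e3 e4. monom 1 e1 + monom 1 e2 - monom 1 e3 - monom 1 e4 :: int poly"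
  \<comment> \<open>Here \<open>X\<^sup>q (X\<^sup>q - 1)* = - (X\<^sup>q - 1)\<close> turns the factor of \<open>f*\<close> into that of \<open>f\<close>; the sign swaps
    the positive and the negative terms on the right-hand side.\<close>
  have "?g (q + ?neg (r * q)) (q + ?neg A) q (q + ?neg (A + s * q))
      = monom 1 q * cyc_star n ((monom 1 q - 1) * ?f)"
    unfolding prishchepov_poly_four_terms
    unfolding cyc_star_add cyc_star_diff cyc_star_monom A_def
    by (simp add: right_diff_distrib distrib_left mult_monom)
  also have "\<dots> = (monom 1 (q + ?neg q) - monom 1 q) * cyc_star n ?f"
    unfolding cyc_star_mult cyc_star_diff cyc_star_monom cyc_star_1
    by (simp add: right_diff_distrib mult_monom flip: mult.assoc)
  also have "cyc_cong n \<dots> ((monom 1 0 - monom 1 q) * (monom 1 c * ?f))"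
  proof (intro cyc_cong_mult cyc_cong_diff cyc_cong_refl c cyc_cong_monom)
    have "q + ?neg q = n * q" using n by (cases n) auto
    then show "[q + ?neg q = 0] (mod n)" by (simp add: cong_0_iff)
  qed
  also have "\<dots> = - (monom 1 c * ((monom 1 q - 1) * ?f))"
    by (simp add: algebra_simps)
  also have "\<dots> = ?g c (c + (A + s * q)) (c + r * q) (c + A)"
    unfolding prishchepov_poly_four_terms by (simp add: algebra_simps mult_monom A_def)
  finally have four: "cyc_cong n (?g (q + ?neg (r * q)) (q + ?neg A) q (q + ?neg (A + s * q)))
      (?g c (c + (A + s * q)) (c + r * q) (c + A))" .
  have toint: "[q + ?neg a = b] (mod n) \<longleftrightarrow> [int b + int a = int q] (mod int n)" for a b
  proof -
    have "[q + ?neg a = b] (mod n) \<longleftrightarrow> [int q + int (?neg a) = int b] (mod int n)"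
      by (metis cong_int_iff of_nat_add)
    also have "\<dots> \<longleftrightarrow> [int q + - int a = int b] (mod int n)"
      using cong_add[OF cong_refl[of "int q"] neg[of a]] by (meson cong_sym cong_trans)
    also have "\<dots> \<longleftrightarrow> [int b + int a = int q] (mod int n)"
      by (simp add: cong_iff_dvd_diff dvd_diff_commute algebra_simps)
    finally show ?thesis .
  qed
  have neg_inj: "[?neg a = ?neg b] (mod n) \<longleftrightarrow> [a = b] (mod n)" for a b
  proof -
    have "[?neg a = ?neg b] (mod n) \<longleftrightarrow> [- int a = - int b] (mod int n)"
      using neg[of a] neg[of b] by (meson cong_int_iff cong_sym cong_trans)
    then show ?thesis by (simp only: cong_minus_minus_iff cong_int_iff)
  qed
  have neg_0: "[q + ?neg a = q] (mod n) \<longleftrightarrow> [a = 0] (mod n)" for a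
    using neg_inj[of a 0] by (simp only: cong_add_lcancel_0_nat mult_0_right)
  have "[A + s * q = r * q] (mod n) \<longleftrightarrow> [A = q] (mod n)"
    by (simp add: r cong_add_rcancel_nat)
  then have "\<not> [r * q = A + s * q] (mod n)" "\<not> [A + s * q = r * q] (mod n)"
    using nk(2) cong_sym by blast+
  moreover have "\<not> [A = A + s * q] (mod n)"
    using nk(4) by (metis cong_add_lcancel_0_nat cong_sym)
  \<comment> \<open>Failure of trivial perfection is exactly what rules out cancellation on both sides.\<close>
  ultimately consider
      "[q + ?neg (r * q) = c] (mod n)" "[q + ?neg A = c + (A + s * q)] (mod n)"
    | "[q + ?neg (r * q) = c + (A + s * q)] (mod n)" "[q + ?neg A = c] (mod n)"
    using four_term_cong[OF n four] nk
    by (metis cong_add_lcancel_0_nat cong_add_lcancel_nat cong_sym neg_0 neg_inj)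
  then show "type_Z_tilde r n k s q"
  proof cases
    case 1
    then have "int n dvd (int c + int (r * q) - int q) - (int (c + (A + s * q)) + int A - int q)"
      unfolding toint cong_iff_dvd_diff by (rule dvd_diff)
    then have "[int q * (int r - int s) = 2 * (int k - 1)] (mod int n)"
      by (simp add: cong_iff_dvd_diff kA algebra_simps)
    then show ?thesis by (simp add: type_Z_tilde_def)
  next
    case 2
    then have "int n dvd (int (c + (A + s * q)) + int (r * q) - int q) - (int c + int A - int q)"
      unfolding toint cong_iff_dvd_diff by (rule dvd_diff)
    then have "[int q * (int r + int s) = 0] (mod int n)"
      by (simp add: cong_iff_dvd_diff algebra_simps)
    then show ?thesis by (simp add: type_Z_tilde_def)
  qed
qed

theorem theorem3:
  fixes r n m M k s q :: nat
  assumes "r \<ge> 1" "n \<ge> 1" "m \<ge> 1" "M \<ge> 1" "k \<ge> 1" "s \<ge> 1" "q \<ge> 1"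
    and "n = 2 ^ m * M" and "gcd M 6 = 1" and "r \<ge> s"
    and "perfect_group (prishchepov r n k s q)"
  shows "trivially_perfect r n k s q \<or> type_Z_tilde r M k s q"
proof -
  have "int M dvd int n"
    using assms(8) by simp
  then have "type_Z_tilde r n k s q \<Longrightarrow> type_Z_tilde r M k s q"
    unfolding type_Z_tilde_def using cong_dvd_modulus by blast
  then show ?thesis
    using perfect_prishchepov_trivially_or_type_Z assms by blast
qed

end
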